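(* Let $X\in\mathbb{R}^{n\times p}$, $Y\in\mathbb{R}^{n\times q}$, $r=\min\{p,q\}$, $\lambda_{\max}=\|X^TY\|_2$, and let $0<\lambda_0\le\lambda_{\max}$. Let $C^*(\lambda_0)$ denote the dual solution at $\lambda_0$, i.e. the Frobenius-norm projection of $Y/\lambda_0$ onto $\Omega_D=\{C\in\mathbb{R}^{n\times q}:\|X^TC\|_2\le1\}$. Let $i\in\{1,\dots,r\}$. If $0<\lambda<\lambda_0$ and $$\lambda>\frac{\lambda_0\|X\|_2\|Y\|_F}{\lambda_0-\lambda_0\sigma_i\big(X^TC^*(\lambda_0)\big)+\|X\|_2\|Y\|_F},$$ then every solution $B^*(\lambda)$ of $\min_{B\in\mathbb{R}^{p\times q}}\{\tfrac12\|Y-XB\|_F^2+\lambda\|B\|_*\}$ satisfies $\sigma_j(B^*(\lambda))=0$ for all $j\ge i$ (with $j\le r$). Moreover, $\mathrm{rank}(B^*(\lambda))\le i-1$.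
   Context: For $M\in\mathbb{R}^{p\times q}$, $\sigma_1(M)\ge\dots\ge\sigma_r(M)\ge0$ are its singular values in nonincreasing order. $\|\cdot\|_F$, $\|\cdot\|_*$, $\|\cdot\|_2$ are the Frobenius, nuclear (sum of singular values) and spectral (largest singular value) norms. The dual problem at parameter $\lambda>0$ is $\min_C\{\tfrac{\lambda^2}{2}\|C-Y/\lambda\|_F^2-\tfrac12\|Y\|_F^2\}$ subject to $\|X^TC\|_2\le1$, whose unique solution is $C^*(\lambda)=P_{\Omega_D}(Y/\lambda)$. *)

theory Defs
  imports "HOL-Analysis.Analysis" "HOL-Computational_Algebra.Polynomial"
begin

(* A p x q matrix is an element of real^'q^'p: the outer index is the row index.
   The norm of this type is the Frobenius norm, and dist the associated distance: *)
lemma norm_eq_Frobenius: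
  fixes M :: "real^'q^'p"
  shows "norm M = sqrt (\<Sum>a\<in>UNIV. \<Sum>b\<in>UNIV. (M $ a $ b)\<^sup>2)"
  by (simp add: norm_vec_def L2_set_def real_sqrt_pow2 sum_nonneg)

definition charpoly :: "'a::comm_ring_1^'n^'n \<Rightarrow> 'a poly" where
  "charpoly A = det (\<chi> a b. (if a = b then [:0, 1:] else 0) - [:A $ a $ b:])"

(* All eigenvalues of a real symmetric matrix are real, so for such A every eigenvalue is
   listed, repeated according to its multiplicity, and the list has length CARD('n). *)
definition eigvals_desc :: "real^'n^'n \<Rightarrow> real list" where
  "eigvals_desc A = rev (sorted_list_of_multiset (proots (charpoly A)))"

definition min_dim :: "real^'q^'p \<Rightarrow> nat" where
  "min_dim M = min CARD('p) CARD('q)"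

(* Indices start at 1; only 1 <= j <= min_dim M is meaningful. If 'q is larger than 'p,
   the eigenvalues of M^T M beyond the first min_dim M ones are all zero. *)
definition sing_val :: "nat \<Rightarrow> real^'q^'p \<Rightarrow> real" where
  "sing_val j M = sqrt (eigvals_desc (transpose M ** M) ! (j - 1))"

definition spectral_norm :: "real^'q^'p \<Rightarrow> real" where
  "spectral_norm M = sing_val 1 M"

definition nuclear_norm :: "real^'q^'p \<Rightarrow> real" where
  "nuclear_norm M = (\<Sum>j = 1..min_dim M. sing_val j M)"

definition primal_objective :: "real^'p^'n \<Rightarrow> real^'q^'n \<Rightarrow> real \<Rightarrow> real^'q^'p \<Rightarrow> real" where
  "primal_objective X Y lam B = 1/2 * (norm (Y - X ** B))\<^sup>2 + lam * nuclear_norm B"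

definition primal_solution :: "real^'p^'n \<Rightarrow> real^'q^'n \<Rightarrow> real \<Rightarrow> real^'q^'p \<Rightarrow> bool" where
  "primal_solution X Y lam B \<longleftrightarrow> is_arg_min (primal_objective X Y lam) (\<lambda>_. True) B"

definition dual_feasible :: "real^'p^'n \<Rightarrow> (real^'q^'n) set" where
  "dual_feasible X = {C. spectral_norm (transpose X ** C) \<le> 1}"

(* The feasible set is nonempty, closed and convex, so the closest point exists and is unique. *)
definition dual_solution :: "real^'p^'n \<Rightarrow> real^'q^'n \<Rightarrow> real \<Rightarrow> real^'q^'n" where
  "dual_solution X Y lam = closest_point (dual_feasible X) ((1 / lam) *\<^sub>R Y)"

end

theory Submission
  imports Defs
begin

text \<open>
  Optimality of B at lambda means that C = (Y - X B) / lambda is the dual solution and that the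
  contraction G = X^T C satisfies <G, B> = ||B||_*. Equality in this spectral/nuclear norm
  pairing forces G to map each right singular vector of B with nonzero singular value to the
  corresponding left singular vector, so if sigma_i(B) > 0 then G is isometric on an i-dimensional
  subspace. Projection onto the dual feasible set is nonexpansive, so G is within
  ||X||_2 ||Y||_F (1 / lambda - 1 / lambda0) of X^T C*(lambda0) in operator norm; hence
  sigma_i(X^T C*(lambda0)) is at least 1 minus this distance, which contradicts the bound on lambda.
\<close>


section \<open>Finite orthonormal sequences\<close>

text \<open>Indexing by naturals rather than by a set lets \<open>v k\<close> be paired with the
  singular value of index \<open>Suc k\<close>. Values of \<open>v\<close> from index
  \<open>m\<close> on are unconstrained.\<close>

definition orthonormal_seq :: "nat \<Rightarrow> (nat \<Rightarrow> 'a::real_inner) \<Rightarrow> bool" where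
  "orthonormal_seq m v \<longleftrightarrow> (\<forall>i<m. \<forall>j<m. v i \<bullet> v j = (if i = j then 1 else 0))"

lemma orthonormal_seqD:
  "orthonormal_seq m v \<Longrightarrow> i < m \<Longrightarrow> j < m \<Longrightarrow> v i \<bullet> v j = (if i = j then 1 else 0)"
  by (simp add: orthonormal_seq_def)

lemma orthonormal_seq_norm: "orthonormal_seq m v \<Longrightarrow> k < m \<Longrightarrow> norm (v k) = 1"
  by (simp add: norm_eq_sqrt_inner orthonormal_seqD)

lemma orthonormal_seq_mono: "orthonormal_seq m v \<Longrightarrow> k \<le> m \<Longrightarrow> orthonormal_seq k v"
  by (simp add: orthonormal_seq_def)

lemma orthonormal_seq_inner_sum:
  assumes "orthonormal_seq m v" "k < m"
  shows "(\<Sum>j<m. c j *\<^sub>R v j) \<bullet> v k = c k"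
proof -
  have "(\<Sum>j<m. c j *\<^sub>R v j) \<bullet> v k = (\<Sum>j<m. if j = k then c j else 0)"
    unfolding inner_sum_left using assms by (intro sum.cong) (auto simp: orthonormal_seqD)
  also have "\<dots> = c k" using assms(2) by simp
  finally show ?thesis .
qed

lemma orthonormal_seq_inner_sums:
  assumes "orthonormal_seq m v"
  shows "(\<Sum>j<m. c j *\<^sub>R v j) \<bullet> (\<Sum>j<m. d j *\<^sub>R v j) = (\<Sum>j<m. c j * d j)"
proof -
  have "(\<Sum>j<m. c j *\<^sub>R v j) \<bullet> (\<Sum>k<m. d k *\<^sub>R v k)
      = (\<Sum>k<m. d k * ((\<Sum>j<m. c j *\<^sub>R v j) \<bullet> v k))"
    by (simp add: inner_sum_right)
  also have "\<dots> = (\<Sum>k<m. c k * d k)"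
    using assms by (intro sum.cong) (auto simp: orthonormal_seq_inner_sum)
  finally show ?thesis .
qed

lemma orthonormal_seq_inj: "orthonormal_seq m v \<Longrightarrow> inj_on v {..<m}"
  unfolding inj_on_def orthonormal_seq_def by (metis lessThan_iff zero_neq_one)

lemma orthonormal_seq_independent:
  assumes "orthonormal_seq m v"
  shows "independent (v ` {..<m})"
proof (rule pairwise_orthogonal_independent)
  show "pairwise orthogonal (v ` {..<m})"
    using assms by (auto simp: pairwise_def orthogonal_def orthonormal_seqD)
  show "0 \<notin> v ` {..<m}"
    using orthonormal_seq_norm[OF assms] by force
qed

lemma orthonormal_seq_dim:
  assumes "orthonormal_seq m v"
  shows "dim (span (v ` {..<m})) = m"
  using dim_eq_card_independent[OF orthonormal_seq_independent[OF assms]]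
    card_image[OF orthonormal_seq_inj[OF assms]] by simp

lemma orthonormal_seq_le_DIM:
  fixes v :: "nat \<Rightarrow> 'a::euclidean_space"
  assumes "orthonormal_seq m v"
  shows "m \<le> DIM('a)"
  using orthonormal_seq_dim[OF assms] dim_subset_UNIV by metis

text \<open>By dimension the sequence spans the whole space, so the remainder \<open>?z\<close>,
  being orthogonal to every \<open>v k\<close>, is orthogonal to itself.\<close>

lemma orthonormal_seq_expand:
  fixes v :: "nat \<Rightarrow> 'a::euclidean_space"
  assumes v: "orthonormal_seq DIM('a) v"
  shows "w = (\<Sum>k<DIM('a). (w \<bullet> v k) *\<^sub>R v k)"
proof -
  let ?z = "w - (\<Sum>k<DIM('a). (w \<bullet> v k) *\<^sub>R v k)"
  have o: "?z \<bullet> v k = 0" if "k < DIM('a)" for k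
    unfolding inner_diff_left orthonormal_seq_inner_sum[OF v that] by simp
  have "span (v ` {..<DIM('a)}) = UNIV"
    using orthonormal_seq_dim[OF v] dim_eq_full by (metis span_span)
  then have "?z \<in> span (v ` {..<DIM('a)})" by simp
  moreover have "orthogonal ?z x" if "x \<in> span (v ` {..<DIM('a)})" for x
    by (rule orthogonal_to_span[OF that]) (auto simp: orthogonal_def o)
  ultimately have "?z = 0" using orthogonal_self by blast
  then show ?thesis by simp
qed

lemma orthonormal_seq_parseval:
  fixes v :: "nat \<Rightarrow> 'a::euclidean_space"
  assumes v: "orthonormal_seq DIM('a) v"
  shows "x \<bullet> y = (\<Sum>k<DIM('a). (x \<bullet> v k) * (y \<bullet> v k))"
  using orthonormal_seq_inner_sums[OF v, of "\<lambda>k. x \<bullet> v k" "\<lambda>k. y \<bullet> v k"]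
  by (simp flip: orthonormal_seq_expand[OF v])

section \<open>First-order conditions and the spectral theorem\<close>

text \<open>For small \<open>t\<close> the linear term dominates. This serves as the first-order
  condition both for the Rayleigh quotient and for the primal problem.\<close>

lemma linear_coeff_zero:
  fixes a b :: real
  assumes "\<And>t. 0 < t \<Longrightarrow> t \<le> 1 \<Longrightarrow> 0 \<le> a * t + b * t\<^sup>2"
  shows "0 \<le> a"
proof (rule ccontr)
  assume "\<not> 0 \<le> a"
  then have a: "a < 0" by simp
  \<comment> \<open>Chosen so that \<open>b * t\<close> is at most \<open>- a / 2\<close>; the
    summand 1 keeps the denominator positive when \<open>b = 0\<close>.\<close>
  define t where "t = min 1 (- a / (2 * (\<bar>b\<bar> + 1)))"
  have t: "0 < t" "t \<le> 1" "t \<le> - a / (2 * (\<bar>b\<bar> + 1))"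
    using a by (auto simp: t_def divide_neg_pos)
  have "b * t \<le> (\<bar>b\<bar> + 1) * t" using t by (intro mult_right_mono) auto
  also have "\<dots> \<le> - a / 2" using t(3) by (simp add: field_simps)
  finally have "a + b * t < 0" using a by linarith
  then have "t * (a + b * t) < 0" using t(1) by (simp add: mult_pos_neg)
  moreover have "0 \<le> t * (a + b * t)"
    using assms[OF t(1,2)] by (simp add: algebra_simps power2_eq_square)
  ultimately show False by simp
qed

text \<open>A maximiser of the quadratic form on the compact unit sphere of \<open>S\<close> is an
  eigenvector, because the first variation vanishes there. The bound on the whole of
  \<open>S\<close> is kept in order to sort eigenvalues later.\<close>

lemma selfadjoint_max_eigenvector:
  fixes f :: "'a::euclidean_space \<Rightarrow> 'a"
  assumes f: "linear f" and sym: "\<And>x y. f x \<bullet> y = x \<bullet> f y"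
    and S: "subspace S" and inv: "f ` S \<subseteq> S" and ne: "dim S > 0"
  obtains v d where "v \<in> S" "norm v = 1" "f v = d *\<^sub>R v"
    "\<And>x. x \<in> S \<Longrightarrow> x \<bullet> f x \<le> d * (norm x)\<^sup>2"
proof -
  let ?K = "S \<inter> sphere 0 1"
  have K: "compact ?K" using closed_subspace[OF S] by (simp add: closed_Int_compact)
  obtain u where u: "u \<in> S" "u \<noteq> 0" using ne
    by (metis dim_eq_0 less_irrefl subsetI singletonI)
  have "(1 / norm u) *\<^sub>R u \<in> ?K" using u S by (simp add: subspace_scale)
  then have Kne: "?K \<noteq> {}" by blast
  have "continuous_on ?K (\<lambda>x. x \<bullet> f x)"
    by (intro continuous_intros linear_continuous_on linear_conv_bounded_linear[THEN iffD1] f)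
  from continuous_attains_sup[OF K Kne this]
  obtain v where v: "v \<in> S" "norm v = 1" and max: "\<And>y. y \<in> ?K \<Longrightarrow> y \<bullet> f y \<le> v \<bullet> f v"
    by auto
  define d where "d = v \<bullet> f v"
  have le: "x \<bullet> f x \<le> d * (norm x)\<^sup>2" if "x \<in> S" for x
  proof (cases "x = 0")
    case False
    let ?y = "(1 / norm x) *\<^sub>R x"
    have "?y \<in> ?K" using that False S by (simp add: subspace_scale)
    from max[OF this] show ?thesis using False
      by (simp add: d_def linear_cmul[OF f] field_simps power2_eq_square)
  qed (simp add: linear_0[OF f])
  have vv: "v \<bullet> v = 1" using v by (simp add: dot_square_norm)
  have nn: "0 \<le> (d *\<^sub>R v - f v) \<bullet> w" if w: "w \<in> S" for w
  proof -
    \<comment> \<open>This is \<open>le\<close> at the perturbed point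
      \<open>v + t *\<^sub>R w\<close>: the constant term vanishes since
      \<open>d = v \<bullet> f v\<close> and \<open>v\<close> is a unit vector, and symmetry of
      \<open>f\<close> merges the two cross terms.\<close>
    have "0 \<le> 2 * ((d *\<^sub>R v - f v) \<bullet> w) * t + (d * (w \<bullet> w) - w \<bullet> f w) * t\<^sup>2" for t
    proof -
      have "v + t *\<^sub>R w \<in> S" using v w S by (simp add: subspace_add subspace_scale)
      from le[OF this] have "0 \<le> d * ((v + t *\<^sub>R w) \<bullet> (v + t *\<^sub>R w)) - (v + t *\<^sub>R w) \<bullet> f (v + t *\<^sub>R w)"
        by (simp add: dot_square_norm)
      also have "\<dots> = 2 * ((d *\<^sub>R v - f v) \<bullet> w) * t + (d * (w \<bullet> w) - w \<bullet> f w) * t\<^sup>2"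
        using sym[of w v] vv
        by (simp add: linear_add[OF f] linear_cmul[OF f] inner_add_left inner_add_right
            inner_diff_left d_def inner_commute power2_eq_square algebra_simps)
      finally show ?thesis .
    qed
    from linear_coeff_zero[OF this] show ?thesis by simp
  qed
  \<comment> \<open>Invariance of \<open>S\<close> makes the eigenvector defect itself an admissible
    direction, and testing with it forces it to be zero.\<close>
  have mem: "f v - d *\<^sub>R v \<in> S" using v inv S by (auto intro!: subspace_diff subspace_scale)
  from nn[OF mem] have "(f v - d *\<^sub>R v) \<bullet> (f v - d *\<^sub>R v) \<le> 0"
    by (simp add: inner_diff_left algebra_simps)
  then have "f v = d *\<^sub>R v" by (metis eq_iff_diff_eq_0 inner_eq_zero_iff inner_ge_zero order_antisym)
  with v le that show ?thesis by blast
qed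

text \<open>Induction on the dimension: split off a maximal eigenvector and continue in its
  orthogonal complement within \<open>S\<close>, which is invariant by symmetry. Maximality over all
  of \<open>S\<close> gives the nonincreasing order of the eigenvalues.\<close>

theorem selfadjoint_orthonormal_eigenvectors:
  fixes f :: "'a::euclidean_space \<Rightarrow> 'a"
  assumes f: "linear f" and sym: "\<And>x y. f x \<bullet> y = x \<bullet> f y"
    and S: "subspace S" and inv: "f ` S \<subseteq> S" and dim: "dim S = m"
  shows "\<exists>v d. v ` {..<m} \<subseteq> S \<and> orthonormal_seq m v \<and> (\<forall>k<m. f (v k) = d k *\<^sub>R v k)
    \<and> (\<forall>j k. j \<le> k \<longrightarrow> k < m \<longrightarrow> d k \<le> (d j :: real))"
  using S inv dim
proof (induction m arbitrary: S)
  case 0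
  then show ?case by (auto simp: orthonormal_seq_def)
next
  case (Suc m)
  from Suc.prems obtain u e where u: "u \<in> S" "norm u = 1" "f u = e *\<^sub>R u"
    and le: "\<And>x. x \<in> S \<Longrightarrow> x \<bullet> f x \<le> e * (norm x)\<^sup>2"
    using selfadjoint_max_eigenvector[OF f sym, of S] by (metis zero_less_Suc)
  have uu: "u \<bullet> u = 1" using u by (simp add: dot_square_norm)
  let ?T = "{y \<in> S. \<forall>x \<in> span {u}. orthogonal x y}"
  have Teq: "?T = {y \<in> S. u \<bullet> y = 0}"
  proof -
    have "(\<forall>x \<in> span {u}. orthogonal x y) \<longleftrightarrow> u \<bullet> y = 0" for y
      by (auto simp: span_singleton orthogonal_def)
    then show ?thesis by auto
  qed
  have "u \<noteq> 0" using u by auto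
  then have "dim (span {u}) = 1" by simp
  then have dT: "dim ?T = m"
    using dim_subspace_orthogonal_to_vectors[OF subspace_span \<open>subspace S\<close>, of "{u}"] Suc.prems(3)
      span_minimal[of "{u}" S] u \<open>subspace S\<close> by simp
  have sT: "subspace ?T" unfolding Teq using \<open>subspace S\<close>
    by (auto simp: subspace_def inner_add_right)
  have iT: "f ` ?T \<subseteq> ?T" unfolding Teq using Suc.prems(2) u(3)
    by (auto simp: sym[symmetric])
  from Suc.IH[OF sT iT dT] obtain v d where v: "v ` {..<m} \<subseteq> ?T" "orthonormal_seq m v"
    "\<forall>k<m. f (v k) = d k *\<^sub>R v k" "\<forall>j k. j \<le> k \<longrightarrow> k < m \<longrightarrow> d k \<le> (d j :: real)" by blast
  let ?v = "\<lambda>k. case k of 0 \<Rightarrow> u | Suc k \<Rightarrow> v k"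
  let ?d = "\<lambda>k. case k of 0 \<Rightarrow> e | Suc k \<Rightarrow> d k"
  have vT: "v k \<in> S" "u \<bullet> v k = 0" "v k \<bullet> u = 0" if "k < m" for k
    using v(1) that unfolding Teq by (auto simp: inner_commute)
  have de: "d k \<le> e" if "k < m" for k
    using le[OF vT(1)[OF that]] v(3) that orthonormal_seq_norm[OF v(2) that]
    by (simp add: dot_square_norm)
  have "?v ` {..<Suc m} \<subseteq> S" using u vT by (auto split: nat.splits)
  moreover have "orthonormal_seq (Suc m) ?v" using v(2) vT uu
    by (auto simp: orthonormal_seq_def split: nat.splits)
  moreover have "\<forall>k<Suc m. f (?v k) = ?d k *\<^sub>R ?v k" using u v(3) by (auto split: nat.splits)
  moreover have "\<forall>j k. j \<le> k \<longrightarrow> k < Suc m \<longrightarrow> ?d k \<le> ?d j" using v(4) de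
    by (auto split: nat.splits)
  ultimately show ?case by blast
qed

section \<open>Characteristic polynomial and singular value decomposition\<close>

text \<open>The orthogonal matrix of eigenvectors is lifted to constant polynomials; it intertwines
  the characteristic matrix with a diagonal one, and its determinant cancels.\<close>

lemma charpoly_eq_prod_eigenvalues:
  fixes A :: "real^'n^'n"
  assumes v: "orthonormal_seq CARD('n) v" and eig: "\<And>k. k < CARD('n) \<Longrightarrow> A *v v k = d k *\<^sub>R v k"
  shows "charpoly A = (\<Prod>k<CARD('n). [:- d k, 1:])"
proof -
  \<comment> \<open>Eigenvectors are numbered by naturals, columns by the type \<open>'n\<close>;
    \<open>h\<close> translates between the two.\<close>
  obtain h where h: "bij_betw h (UNIV::'n set) {..<CARD('n)}"
    using ex_bij_betw_finite_nat[OF finite, of "UNIV::'n set"] by (metis atLeast0LessThan)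
  have hl: "h b < CARD('n)" for b using h by (auto simp: bij_betw_def)
  have hi: "h a = h b \<longleftrightarrow> a = b" for a b using h by (auto simp: bij_betw_def inj_on_def)
  define Q :: "real^'n^'n" where "Q = (\<chi> a b. v (h b) $ a)"
  define Qp :: "real poly^'n^'n" where "Qp = (\<chi> a b. [:Q $ a $ b:])"
  define Ap :: "real poly^'n^'n" where
    "Ap = (\<chi> a b. (if a = b then [:0, 1:] else 0) - [:A $ a $ b:])"
  define Dp :: "real poly^'n^'n" where "Dp = (\<chi> a b. if a = b then [:- d (h b), 1:] else 0)"
  have sum_pCons0: "(\<Sum>x\<in>B. [:g x:]) = [:sum g B:]" for g :: "'n \<Rightarrow> real" and B
    by (induction B rule: infinite_finite_induct) auto
  have QQ: "transpose Qp ** Qp = mat 1"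
  proof -
    have "(\<Sum>c\<in>UNIV. Q $ c $ a * Q $ c $ b) = (if a = b then 1 else 0)" for a b
      using orthonormal_seqD[OF v hl hl, of a b] by (simp add: Q_def inner_vec_def hi)
    then show ?thesis
      by (simp add: vec_eq_iff matrix_matrix_mult_def transpose_def Qp_def mat_def sum_pCons0)
  qed
  have AQ: "Ap ** Qp = Qp ** Dp"
  proof -
    have e: "(\<Sum>c\<in>UNIV. A $ a $ c * Q $ c $ b) = d (h b) * Q $ a $ b" for a b
      using eig[OF hl, of b] by (simp add: vec_eq_iff matrix_vector_mult_def Q_def)
    have "(\<Sum>c\<in>UNIV. ((if a = c then [:0, 1:] else 0) - [:A $ a $ c:]) * [:Q $ c $ b:])
      = [:Q $ a $ b:] * [:- d (h b), 1:]" for a b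
    proof -
      have "(\<Sum>c\<in>UNIV. ((if a = c then [:0, 1:] else 0) - [:A $ a $ c:]) * [:Q $ c $ b:])
        = (\<Sum>c\<in>UNIV. (if a = c then [:0, 1:] * [:Q $ c $ b:] else 0)) - (\<Sum>c\<in>UNIV. [:A $ a $ c * Q $ c $ b:])"
        unfolding sum_subtractf[symmetric] by (intro sum.cong) (auto simp: left_diff_distrib)
      also have "\<dots> = [:Q $ a $ b:] * [:- d (h b), 1:]"
        by (simp add: sum_pCons0 e)
      finally show ?thesis .
    qed
    then show ?thesis
      by (simp add: vec_eq_iff matrix_matrix_mult_def Ap_def Qp_def Dp_def if_distrib cong: if_cong)
  qed
  have "det Qp * det Qp = 1"
    using arg_cong[OF QQ, of det] by (simp add: det_mul)
  moreover have "det Ap * det Qp = det Qp * det Dp"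
    using arg_cong[OF AQ, of det] by (simp add: det_mul)
  moreover have "det Qp \<noteq> 0" using \<open>det Qp * det Qp = 1\<close> by auto
  ultimately have "det Ap = det Dp" by (simp add: mult.commute)
  also have "\<dots> = (\<Prod>b\<in>UNIV. [:- d (h b), 1:])"
    by (subst det_diagonal) (auto simp: Dp_def)
  also have "\<dots> = (\<Prod>k<CARD('n). [:- d k, 1:])"
    by (rule prod.reindex_bij_betw[OF h])
  finally show ?thesis by (simp add: charpoly_def Ap_def)
qed

text \<open>The roots with multiplicity form the multiset of all \<open>d k\<close>, and the
  reversed list of the \<open>d k\<close> is its unique sorted enumeration. Any sorted eigenbasis
  therefore computes \<open>eigvals_desc\<close>.\<close>

lemma eigvals_desc_eq:
  fixes A :: "real^'n^'n"
  assumes v: "orthonormal_seq CARD('n) v" and eig: "\<And>k. k < CARD('n) \<Longrightarrow> A *v v k = d k *\<^sub>R v k"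
    and mono: "\<And>j k. j \<le> k \<Longrightarrow> k < CARD('n) \<Longrightarrow> d k \<le> d j"
  shows "eigvals_desc A = map d [0..<CARD('n)]"
proof -
  have "charpoly A = (\<Prod>k<CARD('n). [:- d k, 1:])"
    by (rule charpoly_eq_prod_eigenvalues[OF v]) (rule eig)
  then have "proots (charpoly A) = (\<Sum>k<CARD('n). {#d k#})"
    by (simp add: proots_prod)
  also have "\<dots> = mset (rev (map d [0..<CARD('n)]))"
    by (simp add: sum_unfold_sum_mset lessThan_atLeast0)
  finally have "proots (charpoly A) = mset (rev (map d [0..<CARD('n)]))" .
  moreover have "sorted (rev (map d [0..<CARD('n)]))"
    using mono by (auto simp: sorted_rev_iff_nth_mono)
  ultimately show ?thesis
    unfolding eigvals_desc_def
    by (metis rev_rev_ident sorted_list_of_multiset_mset sorted_sort_id)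
qed

lemma inner_transpose_matrix_vector:
  fixes M :: "real^'q^'p"
  shows "x \<bullet> (transpose M *v y) = (M *v x) \<bullet> y"
  by (metis dot_lmul_matrix vector_transpose_matrix)

text \<open>The spectral theorem for \<open>transpose M ** M\<close> gives the right singular
  vectors \<open>v k\<close>; their images under \<open>M\<close> are the left ones, scaled by the
  singular values. Vectors count from 0 and singular values from 1, hence
  \<open>Suc k\<close>.\<close>

theorem singular_value_decomposition:
  fixes M :: "real^'q^'p"
  obtains v :: "nat \<Rightarrow> real^'q" where "orthonormal_seq CARD('q) v"
    "\<And>k. k < CARD('q) \<Longrightarrow> transpose M *v (M *v v k) = (sing_val (Suc k) M)\<^sup>2 *\<^sub>R v k"
    "\<And>k. k < CARD('q) \<Longrightarrow> norm (M *v v k) = sing_val (Suc k) M"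
    "\<And>j k. j < CARD('q) \<Longrightarrow> k < CARD('q) \<Longrightarrow> j \<noteq> k \<Longrightarrow> (M *v v j) \<bullet> (M *v v k) = 0"
    "\<And>j k. j \<le> k \<Longrightarrow> k < CARD('q) \<Longrightarrow> sing_val (Suc k) M \<le> sing_val (Suc j) M"
proof -
  let ?A = "transpose M ** M"
  have mv: "?A *v x = transpose M *v (M *v x)" for x
    by (simp add: matrix_vector_mul_assoc)
  have sym: "(?A *v x) \<bullet> y = x \<bullet> (?A *v y)" for x y
    unfolding mv by (metis inner_commute inner_transpose_matrix_vector)
  have lin: "linear (\<lambda>x. ?A *v x)" by (rule matrix_vector_mul_linear)
  obtain v d where v: "orthonormal_seq CARD('q) v" "\<And>k. k < CARD('q) \<Longrightarrow> ?A *v v k = d k *\<^sub>R v k"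
    "\<And>j k. j \<le> k \<Longrightarrow> k < CARD('q) \<Longrightarrow> d k \<le> (d j :: real)"
    using selfadjoint_orthonormal_eigenvectors[OF lin sym subspace_UNIV, of "CARD('q)"] by auto
  have ip: "(M *v v j) \<bullet> (M *v v k) = (if j = k then d k else 0)"
    if "j < CARD('q)" "k < CARD('q)" for j k
  proof -
    have "(M *v v j) \<bullet> (M *v v k) = v j \<bullet> (?A *v v k)"
      unfolding mv inner_transpose_matrix_vector ..
    then show ?thesis using v(1,2) that by (simp add: orthonormal_seqD)
  qed
  have s: "sing_val (Suc k) M = sqrt (d k)" if "k < CARD('q)" for k
    using that eigvals_desc_eq[of v ?A d] v by (simp add: sing_val_def)
  have d0: "0 \<le> d k" if "k < CARD('q)" for k
    using ip[OF that that] by (metis inner_ge_zero)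
  show ?thesis
  proof (rule that[OF v(1)])
    show "transpose M *v (M *v v k) = (sing_val (Suc k) M)\<^sup>2 *\<^sub>R v k" if "k < CARD('q)" for k
      using v(2)[OF that] d0[OF that] s[OF that] by (simp add: mv)
    show "norm (M *v v k) = sing_val (Suc k) M" if "k < CARD('q)" for k
      using ip[OF that that] s[OF that] by (simp add: norm_eq_sqrt_inner)
    show "(M *v v j) \<bullet> (M *v v k) = 0" if "j < CARD('q)" "k < CARD('q)" "j \<noteq> k" for j k
      using ip that by simp
    show "sing_val (Suc k) M \<le> sing_val (Suc j) M" if "j \<le> k" "k < CARD('q)" for j k
      using v(3)[OF that] s that by simp
  qed
qed

section \<open>Singular values and the nuclear norm\<close>

text \<open>Pythagoras: \<open>M\<close> maps the orthonormal basis to pairwise orthogonal vectors,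
  so the mixed terms vanish.\<close>

lemma norm_matrix_vector_expand:
  fixes M :: "real^'q^'p"
  assumes v: "orthonormal_seq CARD('q) v"
    and orth: "\<And>j k. j < CARD('q) \<Longrightarrow> k < CARD('q) \<Longrightarrow> j \<noteq> k \<Longrightarrow> (M *v v j) \<bullet> (M *v v k) = 0"
  shows "(norm (M *v w))\<^sup>2 = (\<Sum>k<CARD('q). (w \<bullet> v k)\<^sup>2 * (norm (M *v v k))\<^sup>2)"
proof -
  let ?n = "CARD('q)"
  have "w = (\<Sum>k<?n. (w \<bullet> v k) *\<^sub>R v k)"
    using orthonormal_seq_expand[of v w] v by simp
  then have "M *v w = M *v (\<Sum>k<?n. (w \<bullet> v k) *\<^sub>R v k)" by simp
  also have "\<dots> = (\<Sum>k<?n. (w \<bullet> v k) *\<^sub>R (M *v v k))"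
    by (simp add: linear_sum[OF matrix_vector_mul_linear, unfolded o_def]
        linear_cmul[OF matrix_vector_mul_linear])
  finally have e: "M *v w = (\<Sum>k<?n. (w \<bullet> v k) *\<^sub>R (M *v v k))" .
  have "(norm (M *v w))\<^sup>2 = (\<Sum>j<?n. \<Sum>k<?n. (w \<bullet> v j) * (w \<bullet> v k) * ((M *v v k) \<bullet> (M *v v j)))"
    unfolding dot_square_norm[symmetric] e
    by (simp add: inner_sum_left inner_sum_right sum_distrib_left mult_ac)
  also have "\<dots> = (\<Sum>j<?n. \<Sum>k<?n. if j = k then (w \<bullet> v k)\<^sup>2 * (norm (M *v v k))\<^sup>2 else 0)"
    by (intro sum.cong) (auto simp: orth dot_square_norm power2_eq_square)
  also have "\<dots> = (\<Sum>k<?n. (w \<bullet> v k)\<^sup>2 * (norm (M *v v k))\<^sup>2)" by simp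
  finally show ?thesis .
qed

lemma sing_val_nonneg:
  fixes M :: "real^'q^'p"
  assumes "k < CARD('q)"
  shows "0 \<le> sing_val (Suc k) M"
  by (rule singular_value_decomposition[of M]) (metis assms norm_ge_zero)

lemma sing_val_antimono:
  fixes M :: "real^'q^'p"
  assumes "j \<le> k" "k < CARD('q)"
  shows "sing_val (Suc k) M \<le> sing_val (Suc j) M"
  by (rule singular_value_decomposition[of M]) (use assms in blast)

text \<open>Half of the Courant--Fischer principle.\<close>

lemma sing_val_bound_on_complement:
  fixes M :: "real^'q^'p"
  obtains v :: "nat \<Rightarrow> real^'q" where
    "\<And>m w. m < CARD('q) \<Longrightarrow> (\<And>k. k < m \<Longrightarrow> w \<bullet> v k = 0) \<Longrightarrow> norm (M *v w) \<le> sing_val (Suc m) M * norm w"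
proof -
  obtain v where v: "orthonormal_seq CARD('q) v"
    "\<And>k. k < CARD('q) \<Longrightarrow> norm (M *v v k) = sing_val (Suc k) M"
    "\<And>j k. j < CARD('q) \<Longrightarrow> k < CARD('q) \<Longrightarrow> j \<noteq> k \<Longrightarrow> (M *v v j) \<bullet> (M *v v k) = 0"
    by (rule singular_value_decomposition[of M]) blast
  have "norm (M *v w) \<le> sing_val (Suc m) M * norm w"
    if m: "m < CARD('q)" and w: "\<And>k. k < m \<Longrightarrow> w \<bullet> v k = 0" for m w
  proof (rule power2_le_imp_le)
    have "(norm (M *v w))\<^sup>2 = (\<Sum>k<CARD('q). (w \<bullet> v k)\<^sup>2 * (sing_val (Suc k) M)\<^sup>2)"
      using norm_matrix_vector_expand[OF v(1,3), of w] v(2) by simp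
    also have "\<dots> \<le> (\<Sum>k<CARD('q). (w \<bullet> v k)\<^sup>2 * (sing_val (Suc m) M)\<^sup>2)"
    proof (rule sum_mono)
      fix k assume k: "k \<in> {..<CARD('q)}"
      show "(w \<bullet> v k)\<^sup>2 * (sing_val (Suc k) M)\<^sup>2 \<le> (w \<bullet> v k)\<^sup>2 * (sing_val (Suc m) M)\<^sup>2"
      proof (cases "k < m")
        case False
        with k have "sing_val (Suc k) M \<le> sing_val (Suc m) M" by (intro sing_val_antimono) auto
        then show ?thesis using sing_val_nonneg k by (intro mult_left_mono power_mono) auto
      qed (simp add: w)
    qed
    also have "\<dots> = (sing_val (Suc m) M)\<^sup>2 * (w \<bullet> w)"
      using orthonormal_seq_parseval[of v w w] v(1)
      by (simp add: sum_distrib_left power2_eq_square mult_ac)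
    also have "\<dots> = (sing_val (Suc m) M * norm w)\<^sup>2" by (simp add: dot_square_norm power_mult_distrib)
    finally show "(norm (M *v w))\<^sup>2 \<le> (sing_val (Suc m) M * norm w)\<^sup>2" .
    show "0 \<le> sing_val (Suc m) M * norm w" using sing_val_nonneg[OF m, of M] by simp
  qed
  then show ?thesis by (rule that)
qed

section \<open>The spectral norm as an operator norm\<close>

text \<open>The case \<open>m = 0\<close> of the bound on complements, where the orthogonality
  condition is empty.\<close>

lemma norm_matrix_vector_le_spectral:
  fixes M :: "real^'q^'p"
  shows "norm (M *v w) \<le> spectral_norm M * norm w"
  by (rule sing_val_bound_on_complement[of M]) (simp add: spectral_norm_def)

lemma spectral_norm_nonneg: "0 \<le> spectral_norm M"
  using sing_val_nonneg[of 0 M] by (simp add: spectral_norm_def)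

text \<open>The operator bound is attained at the first right singular vector. Contractions can then
  be handled vector by vector, without singular values.\<close>

lemma spectral_norm_le_iff:
  fixes M :: "real^'q^'p"
  shows "spectral_norm M \<le> c \<longleftrightarrow> (\<forall>w. norm (M *v w) \<le> c * norm w)"
proof
  assume "spectral_norm M \<le> c"
  then show "\<forall>w. norm (M *v w) \<le> c * norm w"
    using norm_matrix_vector_le_spectral order_trans mult_right_mono norm_ge_zero by meson
next
  assume r: "\<forall>w. norm (M *v w) \<le> c * norm w"
  obtain v where v: "orthonormal_seq CARD('q) v"
    "\<And>k. k < CARD('q) \<Longrightarrow> norm (M *v v k) = sing_val (Suc k) M"
    by (rule singular_value_decomposition[of M]) blast
  show "spectral_norm M \<le> c"
    using r[rule_format, of "v 0"] v(2)[of 0] orthonormal_seq_norm[OF v(1), of 0]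
    by (simp add: spectral_norm_def)
qed

text \<open>The square of the left side is the inner product of
  \<open>M *v (transpose M *v u)\<close> with \<open>u\<close>; Cauchy-Schwarz leaves one factor to
  cancel.\<close>

lemma spectral_norm_transpose_le:
  fixes M :: "real^'q^'p"
  shows "norm (transpose M *v u) \<le> spectral_norm M * norm u"
proof -
  let ?t = "transpose M *v u"
  have "norm ?t * norm ?t = (M *v ?t) \<bullet> u"
    by (metis dot_square_norm inner_transpose_matrix_vector power2_eq_square)
  also have "\<dots> \<le> norm (M *v ?t) * norm u" by (rule norm_cauchy_schwarz)
  also have "\<dots> \<le> spectral_norm M * norm ?t * norm u"
    by (intro mult_right_mono norm_matrix_vector_le_spectral) simp
  finally have "norm ?t * norm ?t \<le> norm ?t * (spectral_norm M * norm u)" by (simp add: mult_ac)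
  then show ?thesis
    by (cases "norm ?t = 0") (use spectral_norm_nonneg[of M] in \<open>auto simp: mult_le_cancel_left\<close>)
qed

text \<open>Cauchy-Schwarz in each row.\<close>

lemma norm_matrix_vector_le_Frobenius:
  fixes M :: "real^'q^'p"
  shows "norm (M *v w) \<le> norm M * norm w"
proof -
  have "norm (M *v w) = L2_set (\<lambda>a. norm ((M *v w) $ a)) UNIV" by (simp add: norm_vec_def)
  also have "\<dots> \<le> L2_set (\<lambda>a. norm (M $ a) * norm w) UNIV"
    by (intro L2_set_mono) (simp_all add: matrix_vector_mul_component Cauchy_Schwarz_ineq2)
  also have "\<dots> = norm M * norm w"
    by (simp add: norm_vec_def L2_set_left_distrib)
  finally show ?thesis .
qed

section \<open>Duality of the spectral and nuclear norms\<close>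

text \<open>The trace form of the Frobenius inner product may be evaluated in any orthonormal basis:
  apply Parseval to each pair of rows and exchange the sums.\<close>

lemma matrix_inner_expand:
  fixes G B :: "real^'q^'p"
  assumes v: "orthonormal_seq CARD('q) v"
  shows "G \<bullet> B = (\<Sum>k<CARD('q). (G *v v k) \<bullet> (B *v v k))"
proof -
  have c: "(G *v w) \<bullet> (B *v w) = (\<Sum>a\<in>UNIV. (G $ a \<bullet> w) * (B $ a \<bullet> w))" for w
    by (subst inner_vec_def) (simp add: matrix_vector_mul_component)
  have "G \<bullet> B = (\<Sum>a\<in>UNIV. (G $ a) \<bullet> (B $ a))" by (rule inner_vec_def)
  also have "\<dots> = (\<Sum>a\<in>UNIV. \<Sum>k<CARD('q). (G $ a \<bullet> v k) * (B $ a \<bullet> v k))"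
    using orthonormal_seq_parseval[of v "G $ a" "B $ a" for a] v by simp
  also have "\<dots> = (\<Sum>k<CARD('q). \<Sum>a\<in>UNIV. (G $ a \<bullet> v k) * (B $ a \<bullet> v k))"
    by (rule sum.swap)
  also have "\<dots> = (\<Sum>k<CARD('q). (G *v v k) \<bullet> (B *v v k))"
    by (simp only: c)
  finally show ?thesis .
qed

lemma orthonormal_seq_normalize:
  fixes u :: "nat \<Rightarrow> 'a::real_inner"
  assumes "\<And>k. k < m \<Longrightarrow> u k \<noteq> 0"
    and "\<And>j k. j < m \<Longrightarrow> k < m \<Longrightarrow> j \<noteq> k \<Longrightarrow> u j \<bullet> u k = 0"
  shows "orthonormal_seq m (\<lambda>k. (1 / norm (u k)) *\<^sub>R u k)"
  using assms by (auto simp: orthonormal_seq_def dot_square_norm power2_eq_square)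

text \<open>Otherwise the first \<open>Suc k\<close> right singular vectors would have nonzero,
  pairwise orthogonal images, too many for the row dimension.\<close>

lemma sing_val_eq_0_beyond_rows:
  fixes M :: "real^'q^'p"
  assumes k: "CARD('p) \<le> k" "k < CARD('q)"
  shows "sing_val (Suc k) M = 0"
proof (rule ccontr)
  assume nz: "sing_val (Suc k) M \<noteq> 0"
  obtain v where v: "orthonormal_seq CARD('q) v"
    "\<And>k. k < CARD('q) \<Longrightarrow> norm (M *v v k) = sing_val (Suc k) M"
    "\<And>j k. j < CARD('q) \<Longrightarrow> k < CARD('q) \<Longrightarrow> j \<noteq> k \<Longrightarrow> (M *v v j) \<bullet> (M *v v k) = 0"
    by (rule singular_value_decomposition[of M]) blast
  have "M *v v j \<noteq> 0" if "j < Suc k" for j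
  proof -
    have "0 < sing_val (Suc k) M" using nz sing_val_nonneg[OF k(2), of M] by simp
    also have "\<dots> \<le> sing_val (Suc j) M" using that k by (intro sing_val_antimono) auto
    finally show ?thesis using v(2)[of j] that k by auto
  qed
  then have "orthonormal_seq (Suc k) (\<lambda>j. (1 / norm (M *v v j)) *\<^sub>R (M *v v j))"
    by (rule orthonormal_seq_normalize) (use v(3) k in auto)
  from orthonormal_seq_le_DIM[OF this] k show False by simp
qed

text \<open>Padding with zero singular values makes the sum run over a full orthonormal basis,
  matching \<open>matrix_inner_expand\<close>.\<close>

lemma nuclear_norm_eq_sum:
  fixes M :: "real^'q^'p"
  shows "nuclear_norm M = (\<Sum>k<CARD('q). sing_val (Suc k) M)"
proof -
  have "nuclear_norm M = (\<Sum>k<min_dim M. sing_val (Suc k) M)"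
    unfolding nuclear_norm_def by (rule sum.reindex_bij_witness[of _ Suc "\<lambda>j. j - 1"]) auto
  also have "\<dots> = (\<Sum>k<CARD('q). sing_val (Suc k) M)"
    by (rule sum.mono_neutral_left) (auto simp: min_dim_def sing_val_eq_0_beyond_rows)
  finally show ?thesis .
qed

text \<open>In the right singular basis of \<open>B\<close>, Cauchy-Schwarz bounds each summand of
  the inner product by one singular value.\<close>

lemma contraction_inner_le_nuclear:
  fixes G B :: "real^'q^'p"
  assumes G: "spectral_norm G \<le> 1"
  shows "G \<bullet> B \<le> nuclear_norm B"
proof -
  obtain v where v: "orthonormal_seq CARD('q) v"
    "\<And>k. k < CARD('q) \<Longrightarrow> norm (B *v v k) = sing_val (Suc k) B"
    by (rule singular_value_decomposition[of B]) blast
  have "(G *v v k) \<bullet> (B *v v k) \<le> sing_val (Suc k) B" if k: "k < CARD('q)" for k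
  proof -
    have "norm (G *v v k) \<le> 1"
      using G orthonormal_seq_norm[OF v(1) k] unfolding spectral_norm_le_iff by (metis mult_1)
    then have "norm (G *v v k) * norm (B *v v k) \<le> 1 * norm (B *v v k)"
      by (rule mult_right_mono) simp
    then show ?thesis using norm_cauchy_schwarz[of "G *v v k" "B *v v k"] v(2)[OF k] by simp
  qed
  then show ?thesis
    unfolding nuclear_norm_eq_sum matrix_inner_expand[OF v(1)] by (intro sum_mono) auto
qed

text \<open>The polar factor sends each right singular vector with nonzero image to the normalised
  image, which gives equality in every summand of the duality bound.\<close>

lemma nuclear_norm_attained:
  fixes B :: "real^'q^'p"
  obtains G :: "real^'q^'p" where "spectral_norm G \<le> 1" "G \<bullet> B = nuclear_norm B"
proof -
  let ?n = "CARD('q)"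
  obtain v where v: "orthonormal_seq ?n v"
    "\<And>k. k < ?n \<Longrightarrow> norm (B *v v k) = sing_val (Suc k) B"
    "\<And>j k. j < ?n \<Longrightarrow> k < ?n \<Longrightarrow> j \<noteq> k \<Longrightarrow> (B *v v j) \<bullet> (B *v v k) = 0"
    by (rule singular_value_decomposition[of B]) blast
  \<comment> \<open>The polar factor of B; it vanishes on the kernel of B because 1 / 0 = 0.\<close>
  define f where "f w = (\<Sum>k<?n. (w \<bullet> v k) *\<^sub>R ((1 / norm (B *v v k)) *\<^sub>R (B *v v k)))" for w
  define G where "G = matrix f"
  have "linear f" unfolding f_def
    by (intro linearI) (simp_all add: inner_add_left scaleR_left_distrib add_divide_distrib sum.distrib scaleR_sum_right)
  then have Gf: "G *v w = f w" for w unfolding G_def by (simp add: matrix_works)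
  have Gv: "G *v v k = (1 / norm (B *v v k)) *\<^sub>R (B *v v k)" if k: "k < ?n" for k
  proof -
    have "f (v k) = (\<Sum>j<?n. if j = k then (1 / norm (B *v v k)) *\<^sub>R (B *v v k) else 0)"
      unfolding f_def using v(1) k by (intro sum.cong) (auto simp: orthonormal_seqD)
    then show ?thesis using k by (simp add: Gf)
  qed
  have "norm (G *v w) \<le> 1 * norm w" for w
  proof (rule power2_le_imp_le)
    \<comment> \<open>The images of the \<open>v k\<close> under \<open>G\<close> inherit
      orthogonality from those under \<open>B\<close>; each has norm 1 or 0.\<close>
    have "(norm (G *v w))\<^sup>2 = (\<Sum>k<?n. (w \<bullet> v k)\<^sup>2 * (norm (G *v v k))\<^sup>2)"
      by (rule norm_matrix_vector_expand[OF v(1)]) (simp add: Gv v(3))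
    also have "\<dots> \<le> (\<Sum>k<?n. (w \<bullet> v k)\<^sup>2 * 1)"
      by (intro sum_mono mult_left_mono) (auto simp: Gv)
    also have "\<dots> = w \<bullet> w"
      using orthonormal_seq_parseval[of v w w] v(1) by (simp add: power2_eq_square)
    finally show "(norm (G *v w))\<^sup>2 \<le> (1 * norm w)\<^sup>2" by (simp add: dot_square_norm)
  qed simp
  then have "spectral_norm G \<le> 1" by (simp add: spectral_norm_le_iff)
  moreover have "G \<bullet> B = nuclear_norm B"
    unfolding nuclear_norm_eq_sum matrix_inner_expand[OF v(1)]
    by (intro sum.cong) (auto simp: Gv v(2)[symmetric] dot_square_norm power2_eq_square)
  ultimately show ?thesis by (rule that)
qed

text \<open>Expresses the nuclear norm as a supremum of linear functionals, from which homogeneity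
  and the triangle inequality follow at once.\<close>

lemma nuclear_norm_le:
  assumes "\<And>G. spectral_norm G \<le> 1 \<Longrightarrow> G \<bullet> B \<le> c"
  shows "nuclear_norm B \<le> c"
  using nuclear_norm_attained[of B] assms by metis

lemma nuclear_norm_scale:
  assumes "0 \<le> c"
  shows "nuclear_norm (c *\<^sub>R B) \<le> c * nuclear_norm B"
  by (rule nuclear_norm_le) (simp add: assms contraction_inner_le_nuclear mult_left_mono)

lemma nuclear_norm_add: "nuclear_norm (A + B) \<le> nuclear_norm A + nuclear_norm B"
  by (rule nuclear_norm_le) (simp add: inner_add_right add_mono contraction_inner_le_nuclear)

section \<open>Optimality and screening\<close>

text \<open>The other half of the Courant--Fischer principle.\<close>

lemma sing_val_ge_of_subspace:
  fixes M :: "real^'q^'p"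
  assumes u: "orthonormal_seq (Suc m) u"
    and c: "\<And>w. w \<in> span (u ` {..<Suc m}) \<Longrightarrow> c * norm w \<le> norm (M *v w)"
  shows "c \<le> sing_val (Suc m) M"
proof -
  have m: "m < CARD('q)" using orthonormal_seq_le_DIM[OF u] by simp
  obtain v :: "nat \<Rightarrow> real^'q" where v: "\<And>w. (\<And>k. k < m \<Longrightarrow> w \<bullet> v k = 0) \<Longrightarrow> norm (M *v w) \<le> sing_val (Suc m) M * norm w"
    by (rule sing_val_bound_on_complement[of M]) (use m in blast)
  let ?W = "span (u ` {..<Suc m})" and ?V = "span (v ` {..<m})"
  let ?O = "{y \<in> UNIV. \<forall>x\<in>?V. orthogonal x y}"
  have "dim ?V \<le> card (v ` {..<m})" unfolding dim_span by (rule dim_le_card') simp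
  also have "\<dots> \<le> m" using card_image_le[of "{..<m}" v] by simp
  finally have dV: "dim ?V \<le> m" .
  have sO: "subspace ?O" by (auto simp: subspace_def orthogonal_def inner_add_right)
  have "dim ?O + dim ?V = CARD('q)"
    using dim_subspace_orthogonal_to_vectors[OF subspace_span subspace_UNIV, of "v ` {..<m}"] by simp
  \<comment> \<open>The set of sums is \<open>?W\<close> plus \<open>?O\<close>. Dimensions
    \<open>Suc m\<close> and at least \<open>CARD('q) - m\<close> inside a space of dimension
    \<open>CARD('q)\<close> force a nonzero common vector.\<close>
  moreover have "dim {x + y |x y. x \<in> ?W \<and> y \<in> ?O} + dim (?W \<inter> ?O) = Suc m + dim ?O"
    using dim_sums_Int[OF subspace_span sO, of "u ` {..<Suc m}"] orthonormal_seq_dim[OF u] by simp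
  moreover have "dim {x + y |x y. x \<in> ?W \<and> y \<in> ?O} \<le> CARD('q)"
    using dim_subset_UNIV[of "{x + y |x y. x \<in> ?W \<and> y \<in> ?O}"] by simp
  ultimately have "dim (?W \<inter> ?O) \<noteq> 0" using dV by linarith
  then obtain w where w: "w \<in> ?W" "w \<in> ?O" "w \<noteq> 0" unfolding dim_eq_0 by blast
  have "w \<bullet> v k = 0" if "k < m" for k
    using w(2) that span_base[of "v k" "v ` {..<m}"] by (auto simp: orthogonal_def inner_commute)
  from v[OF this] c[OF w(1)] have "c * norm w \<le> sing_val (Suc m) M * norm w" by linarith
  then show ?thesis using w(3) by simp
qed

text \<open>By monotonicity all \<open>v k\<close> with \<open>k\<close> at least \<open>m\<close>
  are mapped to zero, so the images of the first \<open>m\<close> vectors span the range.\<close>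

lemma rank_le_of_sing_val_eq_0:
  fixes B :: "real^'q^'p"
  assumes m: "m < CARD('q)" and s: "sing_val (Suc m) B = 0"
  shows "rank B \<le> m"
proof -
  let ?n = "CARD('q)"
  obtain v where v: "orthonormal_seq ?n v" "\<And>k. k < ?n \<Longrightarrow> norm (B *v v k) = sing_val (Suc k) B"
    by (rule singular_value_decomposition[of B]) blast
  have z: "B *v v k = 0" if "m \<le> k" "k < ?n" for k
    using sing_val_antimono[OF that, of B] v(2)[OF that(2)] s
    by (metis norm_le_zero_iff)
  have "B *v w \<in> span ((\<lambda>k. B *v v k) ` {..<m})" for w
  proof -
    have "w = (\<Sum>k<?n. (w \<bullet> v k) *\<^sub>R v k)"
      using orthonormal_seq_expand[of v w] v(1) by simp
    then have "B *v w = B *v (\<Sum>k<?n. (w \<bullet> v k) *\<^sub>R v k)" by simp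
    also have "\<dots> = (\<Sum>k<?n. (w \<bullet> v k) *\<^sub>R (B *v v k))"
      by (simp add: linear_sum[OF matrix_vector_mul_linear, unfolded o_def]
          linear_cmul[OF matrix_vector_mul_linear])
    also have "\<dots> = (\<Sum>k<m. (w \<bullet> v k) *\<^sub>R (B *v v k))"
      by (rule sum.mono_neutral_right) (use m z in auto)
    also have "\<dots> \<in> span ((\<lambda>k. B *v v k) ` {..<m})"
      by (intro span_sum span_scale span_base) auto
    finally show ?thesis .
  qed
  then have "dim (range (\<lambda>x. B *v x)) \<le> card ((\<lambda>k. B *v v k) ` {..<m})"
    by (intro dim_le_card) auto
  also have "\<dots> \<le> m" using card_image_le[of "{..<m}" "\<lambda>k. B *v v k"] by simp
  finally show ?thesis by (simp add: rank_dim_range)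
qed

text \<open>Equality in the duality bound means equality in each summand. A contraction then has to
  map \<open>v k\<close> to the normalised left singular vector, so it carries one orthonormal
  system to another.\<close>

lemma nuclear_certificate_isometry:
  fixes G B :: "real^'q^'p"
  assumes G: "spectral_norm G \<le> 1" and eq: "G \<bullet> B = nuclear_norm B"
    and m: "m < CARD('q)" and nz: "sing_val (Suc m) B \<noteq> 0"
  obtains v where "orthonormal_seq (Suc m) v"
    "\<And>w. w \<in> span (v ` {..<Suc m}) \<Longrightarrow> norm (G *v w) = norm w"
proof -
  let ?n = "CARD('q)"
  obtain v where v: "orthonormal_seq ?n v"
    "\<And>k. k < ?n \<Longrightarrow> norm (B *v v k) = sing_val (Suc k) B"
    "\<And>j k. j < ?n \<Longrightarrow> k < ?n \<Longrightarrow> j \<noteq> k \<Longrightarrow> (B *v v j) \<bullet> (B *v v k) = 0"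
    by (rule singular_value_decomposition[of B]) blast
  have nG: "norm (G *v v k) \<le> 1" if k: "k < ?n" for k
    using G orthonormal_seq_norm[OF v(1) k] unfolding spectral_norm_le_iff by (metis mult_1)
  have le: "(G *v v k) \<bullet> (B *v v k) \<le> norm (B *v v k)" if k: "k < ?n" for k
  proof -
    have "norm (G *v v k) * norm (B *v v k) \<le> 1 * norm (B *v v k)"
      using nG[OF k] by (rule mult_right_mono) simp
    then show ?thesis using norm_cauchy_schwarz[of "G *v v k" "B *v v k"] by simp
  qed
  \<comment> \<open>The gaps are nonnegative by \<open>le\<close>; a zero total makes each of them
    zero.\<close>
  have "(\<Sum>k<?n. norm (B *v v k) - (G *v v k) \<bullet> (B *v v k)) = 0"
    using eq v(2) by (simp add: sum_subtractf nuclear_norm_eq_sum matrix_inner_expand[OF v(1)])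
  then have ev: "(G *v v k) \<bullet> (B *v v k) = norm (B *v v k)" if "k < ?n" for k
    using that le by (subst (asm) sum_nonneg_eq_0_iff) auto
  have Bnz: "B *v v k \<noteq> 0" if "k < Suc m" for k
  proof -
    have "0 < sing_val (Suc m) B" using nz sing_val_nonneg[OF m, of B] by simp
    also have "\<dots> \<le> sing_val (Suc k) B" using that m by (intro sing_val_antimono) auto
    finally show ?thesis using v(2)[of k] that m by auto
  qed
  let ?u = "\<lambda>k. (1 / norm (B *v v k)) *\<^sub>R (B *v v k)"
  have u: "orthonormal_seq (Suc m) ?u"
    by (rule orthonormal_seq_normalize) (use Bnz v(3) m in auto)
  have Gu: "G *v v k = ?u k" if k: "k < Suc m" for k
  proof -
    have "(G *v v k) \<bullet> ?u k = 1" using ev[of k] Bnz[OF k] k m by simp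
    moreover have "?u k \<bullet> ?u k = 1" using orthonormal_seqD[OF u k k] by simp
    moreover have "(G *v v k) \<bullet> (G *v v k) \<le> 1"
      using nG[of k] k m by (simp add: dot_square_norm power_le_one)
    \<comment> \<open>The square expands to at most 1 - 2 + 1: this is the equality case of
      Cauchy-Schwarz.\<close>
    ultimately have "(G *v v k - ?u k) \<bullet> (G *v v k - ?u k) \<le> 0"
      by (simp only: inner_diff_left inner_diff_right inner_commute[of "?u k" "G *v v k"])
    then show ?thesis by (metis eq_iff_diff_eq_0 inner_eq_zero_iff inner_ge_zero order_antisym)
  qed
  have vm: "orthonormal_seq (Suc m) v" using v(1) m by (simp add: orthonormal_seq_mono)
  show ?thesis
  proof (rule that[OF vm])
    fix w assume "w \<in> span (v ` {..<Suc m})"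
    then obtain c where "w = (\<Sum>x\<in>v ` {..<Suc m}. c x *\<^sub>R x)"
      by (auto simp: span_finite)
    \<comment> \<open>The coefficients come indexed by vectors; injectivity of \<open>v\<close>
      turns them into coefficients over indices.\<close>
    then have w: "w = (\<Sum>k<Suc m. c (v k) *\<^sub>R v k)"
      by (simp only: sum.reindex[OF orthonormal_seq_inj[OF vm]] o_def)
    have "G *v w = (\<Sum>k<Suc m. c (v k) *\<^sub>R (G *v v k))"
      unfolding w by (simp only: linear_sum[OF matrix_vector_mul_linear, unfolded o_def]
        linear_cmul[OF matrix_vector_mul_linear])
    also have "\<dots> = (\<Sum>k<Suc m. c (v k) *\<^sub>R ?u k)"
      by (intro sum.cong) (auto simp only: Gu lessThan_iff)
    finally have "(G *v w) \<bullet> (G *v w) = w \<bullet> w"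
      unfolding w by (simp only: orthonormal_seq_inner_sums[OF vm] orthonormal_seq_inner_sums[OF u])
    then show "norm (G *v w) = norm w" by (simp add: norm_eq_sqrt_inner)
  qed
qed

section \<open>First-order optimality of the primal problem\<close>

lemma inner_transpose_matrix_mult:
  fixes X :: "real^'p^'n" and A :: "real^'q^'p" and C :: "real^'q^'n"
  shows "A \<bullet> (transpose X ** C) = (X ** A) \<bullet> C"
proof -
  have "A \<bullet> (transpose X ** C) = (\<Sum>k\<in>UNIV. \<Sum>b\<in>UNIV. \<Sum>a\<in>UNIV. A $ k $ b * (X $ a $ k * C $ a $ b))"
    by (simp add: inner_vec_def matrix_matrix_mult_def transpose_def sum_distrib_left)
  also have "\<dots> = (\<Sum>k\<in>UNIV. \<Sum>a\<in>UNIV. \<Sum>b\<in>UNIV. A $ k $ b * (X $ a $ k * C $ a $ b))"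
    by (intro sum.cong refl sum.swap)
  also have "\<dots> = (\<Sum>a\<in>UNIV. \<Sum>k\<in>UNIV. \<Sum>b\<in>UNIV. A $ k $ b * (X $ a $ k * C $ a $ b))"
    by (rule sum.swap)
  also have "\<dots> = (\<Sum>a\<in>UNIV. \<Sum>b\<in>UNIV. \<Sum>k\<in>UNIV. A $ k $ b * (X $ a $ k * C $ a $ b))"
    by (intro sum.cong refl sum.swap)
  also have "\<dots> = (X ** A) \<bullet> C"
    by (simp add: inner_vec_def matrix_matrix_mult_def sum_distrib_left sum_distrib_right mult_ac)
  finally show ?thesis .
qed

text \<open>Rank-one test matrices turn statements about matrix inner products into statements about
  vectors.\<close>

lemma inner_outer_product:
  fixes H :: "real^'q^'p"
  shows "H \<bullet> (\<chi> a b. y $ a * w $ b) = (H *v w) \<bullet> y"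
  by (simp add: inner_vec_def matrix_vector_mult_def sum_distrib_left sum_distrib_right mult_ac)

lemma matrix_mult_diff_right: "X ** (A - B) = X ** A - X ** (B :: real^'q^'p)"
  by (simp add: vec_eq_iff matrix_matrix_mult_def right_diff_distrib sum_subtractf)

lemma matrix_mult_scaleR_right: "X ** (c *\<^sub>R A) = c *\<^sub>R (X ** (A :: real^'q^'p))"
  by (simp add: vec_eq_iff matrix_matrix_mult_def sum_distrib_left mult_ac)

text \<open>The objective at \<open>B\<close> is compared with that on the segment towards
  \<open>B'\<close>: convexity bounds the nuclear norm, the smooth part is quadratic in
  \<open>t\<close>, and \<open>linear_coeff_zero\<close> keeps only the first-order term.\<close>

lemma primal_subgradient:
  fixes X :: "real^'p^'n" and B :: "real^'q^'p"
  assumes B: "primal_solution X Y lam B" and lam: "0 < lam"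
  shows "(transpose X ** (Y - X ** B)) \<bullet> (B' - B) \<le> lam * (nuclear_norm B' - nuclear_norm B)"
proof -
  define R where "R = Y - X ** B"
  define D where "D = X ** (B' - B)"
  have "0 \<le> (lam * (nuclear_norm B' - nuclear_norm B) - R \<bullet> D) * t + (1/2 * (norm D)\<^sup>2) * t\<^sup>2"
    if t: "0 < t" "t \<le> 1" for t
  proof -
    let ?Bt = "(1 - t) *\<^sub>R B + t *\<^sub>R B'"
    have "primal_objective X Y lam B \<le> primal_objective X Y lam ?Bt"
      using B by (simp add: primal_solution_def is_arg_min_def not_less)
    moreover have "Y - X ** ?Bt = R - t *\<^sub>R D"
      by (simp add: R_def D_def matrix_add_ldistrib matrix_mult_scaleR_right matrix_mult_diff_right algebra_simps)
    moreover have "(norm (R - t *\<^sub>R D))\<^sup>2 = (norm R)\<^sup>2 - 2 * t * (R \<bullet> D) + t\<^sup>2 * (norm D)\<^sup>2"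
      unfolding dot_square_norm[symmetric]
      by (simp only: inner_diff_left inner_diff_right inner_scaleR_left inner_scaleR_right
          inner_commute[of D R] power2_eq_square) (simp add: algebra_simps)
    moreover have "nuclear_norm ?Bt \<le> (1 - t) * nuclear_norm B + t * nuclear_norm B'"
      using nuclear_norm_add[of "(1 - t) *\<^sub>R B" "t *\<^sub>R B'"] nuclear_norm_scale[of "1 - t" B]
        nuclear_norm_scale[of t B'] t by linarith
    then have "lam * nuclear_norm ?Bt \<le> lam * ((1 - t) * nuclear_norm B + t * nuclear_norm B')"
      using lam by (simp add: mult_left_mono)
    ultimately have "1/2 * (norm R)\<^sup>2 + lam * nuclear_norm B
      \<le> 1/2 * ((norm R)\<^sup>2 - 2 * t * (R \<bullet> D) + t\<^sup>2 * (norm D)\<^sup>2)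
        + lam * ((1 - t) * nuclear_norm B + t * nuclear_norm B')"
      unfolding primal_objective_def R_def[symmetric] by (simp only:)
    then show ?thesis by (simp add: algebra_simps)
  qed
  from linear_coeff_zero[OF this] show ?thesis
    using inner_transpose_matrix_mult[of "B' - B" X R]
    by (simp add: R_def D_def inner_commute[of "transpose X ** (Y - X ** B)"] inner_commute[of "Y - X ** B"])
qed

text \<open>The subgradient inequality is tested at multiples of \<open>B\<close> for the equality
  and at rank-one matrices for the norm bound.\<close>

lemma primal_certificate:
  fixes X :: "real^'p^'n" and B :: "real^'q^'p"
  assumes B: "primal_solution X Y lam B" and lam: "0 < lam"
  defines "G \<equiv> transpose X ** ((1 / lam) *\<^sub>R (Y - X ** B))"
  shows "spectral_norm G \<le> 1" "G \<bullet> B = nuclear_norm B"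
proof -
  have sub: "G \<bullet> (B' - B) \<le> nuclear_norm B' - nuclear_norm B" for B'
    using primal_subgradient[OF B lam, of B'] lam
    by (simp only: G_def matrix_mult_scaleR_right inner_scaleR_left) (simp add: pos_divide_le_eq mult.commute)
  \<comment> \<open>The test points 0 and twice \<open>B\<close> give the two opposite
    inequalities.\<close>
  have "nuclear_norm B \<le> G \<bullet> B"
    using sub[of "0 *\<^sub>R B"] nuclear_norm_scale[of 0 B] by simp
  moreover have "G \<bullet> B \<le> nuclear_norm B"
    using sub[of "2 *\<^sub>R B"] nuclear_norm_scale[of 2 B] by (simp add: inner_diff_right)
  ultimately show e: "G \<bullet> B = nuclear_norm B" by simp
  have "norm (G *v w) \<le> 1 * norm w" for w
  proof -
    \<comment> \<open>For this rank-one matrix \<open>G \<bullet> ?B\<close> is the square of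
      \<open>norm (G *v w)\<close>. A contraction \<open>H\<close> attaining its nuclear norm bounds
      that norm without computing singular values.\<close>
    let ?B = "(\<chi> a b. (G *v w) $ a * w $ b) :: real^'q^'p"
    obtain H :: "real^'q^'p" where H: "spectral_norm H \<le> 1" "H \<bullet> ?B = nuclear_norm ?B"
      by (rule nuclear_norm_attained)
    have "norm (G *v w) * norm (G *v w) = G \<bullet> ?B"
      by (simp add: inner_outer_product dot_square_norm power2_eq_square)
    also have "\<dots> \<le> nuclear_norm ?B" using sub[of ?B] e by (simp add: inner_diff_right)
    also have "\<dots> = (H *v w) \<bullet> (G *v w)" using H(2) by (simp add: inner_outer_product)
    also have "\<dots> \<le> norm (H *v w) * norm (G *v w)" by (rule norm_cauchy_schwarz)
    also have "\<dots> \<le> norm w * norm (G *v w)"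
      using H(1) unfolding spectral_norm_le_iff by (intro mult_right_mono) auto
    finally show ?thesis by (cases "norm (G *v w) = 0") (auto simp: mult_le_cancel_right)
  qed
  then show "spectral_norm G \<le> 1" by (simp add: spectral_norm_le_iff)
qed

section \<open>Projection onto the dual feasible set\<close>

text \<open>One constraint for each \<open>w\<close>: the set becomes an intersection of closed
  convex sets.\<close>

lemma dual_feasible_iff:
  "C \<in> dual_feasible X \<longleftrightarrow> (\<forall>w. norm (transpose X *v (C *v w)) \<le> norm w)"
  by (simp add: dual_feasible_def spectral_norm_le_iff matrix_vector_mul_assoc)

lemma bounded_linear_matrix_vector_left: "bounded_linear (\<lambda>C :: real^'q^'n. C *v w)"
  by (intro linear_conv_bounded_linear[THEN iffD1] linearI)
     (simp_all add: matrix_vector_mult_add_rdistrib scaleR_matrix_vector_assoc)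

lemma zero_in_dual_feasible: "0 \<in> dual_feasible X"
  by (simp add: dual_feasible_iff)

lemma convex_dual_feasible: "convex (dual_feasible (X :: real^'p^'n) :: (real^'q^'n) set)"
proof (rule convexI)
  fix A C :: "real^'q^'n" and s t :: real
  assume AC: "A \<in> dual_feasible X" "C \<in> dual_feasible X" and st: "0 \<le> s" "0 \<le> t" "s + t = 1"
  have "norm (transpose X *v ((s *\<^sub>R A + t *\<^sub>R C) *v w)) \<le> norm w" for w
  proof -
    have "transpose X *v ((s *\<^sub>R A + t *\<^sub>R C) *v w)
        = s *\<^sub>R (transpose X *v (A *v w)) + t *\<^sub>R (transpose X *v (C *v w))"
      by (simp only: matrix_vector_mult_add_rdistrib matrix_vector_right_distrib
          scaleR_matrix_vector_assoc[symmetric] matrix_vector_mult_scaleR)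
    also have "norm \<dots> \<le> s * norm w + t * norm w"
      using AC st unfolding dual_feasible_iff
      by (intro norm_triangle_mono) (auto intro!: mult_left_mono)
    also have "\<dots> = norm w" using st by (simp flip: distrib_right)
    finally show ?thesis .
  qed
  then show "s *\<^sub>R A + t *\<^sub>R C \<in> dual_feasible X" by (simp add: dual_feasible_iff)
qed

lemma closed_dual_feasible: "closed (dual_feasible (X :: real^'p^'n) :: (real^'q^'n) set)"
proof -
  have "dual_feasible X = (\<Inter>w. {C :: real^'q^'n. norm (transpose X *v (C *v w)) \<le> norm w})"
    by (auto simp: dual_feasible_iff)
  also have "closed \<dots>"
    by (intro closed_INT ballI closed_Collect_le continuous_intros
        bounded_linear.continuous_on[OF matrix_vector_mul_bounded_linear]
        bounded_linear.continuous_on[OF bounded_linear_matrix_vector_left])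
  finally show ?thesis .
qed

text \<open>The certificate makes the scaled residual \<open>?C\<close> feasible. The variational
  inequality of the projection holds because \<open>?a - ?C\<close> is a positive multiple of
  \<open>X ** B\<close>, whose pairing with feasible points is at most
  \<open>nuclear_norm B\<close>, with equality at \<open>?C\<close>.\<close>

lemma dual_solution_eq_residual:
  fixes X :: "real^'p^'n" and B :: "real^'q^'p"
  assumes B: "primal_solution X Y lam B" and lam: "0 < lam"
  shows "dual_solution X Y lam = (1 / lam) *\<^sub>R (Y - X ** B)"
proof -
  let ?C = "(1 / lam) *\<^sub>R (Y - X ** B)" and ?a = "(1 / lam) *\<^sub>R Y"
  note cert = primal_certificate[OF B lam]
  have C: "?C \<in> dual_feasible X" using cert(1) by (simp add: dual_feasible_def)
  have "dist ?a ?C \<le> dist ?a z" if z: "z \<in> dual_feasible X" for z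
  proof -
    have "(X ** B) \<bullet> (z - ?C) = B \<bullet> (transpose X ** z) - B \<bullet> (transpose X ** ?C)"
      by (simp only: inner_diff_right inner_transpose_matrix_mult)
    also have "\<dots> \<le> 0"
      using contraction_inner_le_nuclear[of "transpose X ** z" B] z cert(2)
      by (simp add: dual_feasible_def inner_commute)
    finally have "0 \<le> - ((X ** B) \<bullet> (z - ?C)) / lam"
      using lam by (simp add: divide_nonpos_pos)
    moreover have "?a - ?C = (1 / lam) *\<^sub>R (X ** B)" by (simp add: scaleR_diff_right)
    ultimately have "(?a - ?C) \<bullet> (z - ?C) \<le> 0" by simp
    moreover have "(norm (?a - z))\<^sup>2 = (norm (?a - ?C))\<^sup>2 - 2 * ((?a - ?C) \<bullet> (z - ?C)) + (norm (z - ?C))\<^sup>2"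
      using dot_norm_neg[of "?a - ?C" "z - ?C"] by simp
    ultimately have "(norm (?a - ?C))\<^sup>2 \<le> (norm (?a - z))\<^sup>2"
      using zero_le_power2[of "norm (z - ?C)"] by linarith
    then show ?thesis unfolding dist_norm by (rule power2_le_imp_le) simp
  qed
  with C show ?thesis
    unfolding dual_solution_def
    using closest_point_unique[OF convex_dual_feasible closed_dual_feasible C, of ?a] by simp
qed

text \<open>Both solutions are projections of multiples of \<open>Y\<close> onto the same closed
  convex set, and such projections are nonexpansive.\<close>

lemma norm_dual_solution_diff_le:
  assumes "0 < lam" "lam \<le> mu"
  shows "norm (dual_solution X Y lam - dual_solution X Y mu) \<le> (1 / lam - 1 / mu) * norm Y"
proof -
  have "dist (dual_solution X Y lam) (dual_solution X Y mu) \<le> dist ((1 / lam) *\<^sub>R Y) ((1 / mu) *\<^sub>R Y)"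
    unfolding dual_solution_def
    by (intro closest_point_lipschitz convex_dual_feasible closed_dual_feasible) (use zero_in_dual_feasible in blast)
  also have "\<dots> = \<bar>1 / lam - 1 / mu\<bar> * norm Y" by (simp add: dist_norm flip: scaleR_diff_left)
  also have "\<bar>1 / lam - 1 / mu\<bar> = 1 / lam - 1 / mu" using assms by (simp add: frac_le)
  finally show ?thesis by (simp add: dist_norm)
qed

section \<open>The screening rule\<close>

lemma screening_sing_val_eq_0:
  fixes X :: "real^'p^'n" and B :: "real^'q^'p"
  assumes lam: "0 < lam" "lam \<le> mu" and B: "primal_solution X Y lam B" and m: "m < CARD('q)"
    and small: "sing_val (Suc m) (transpose X ** dual_solution X Y mu)
      + spectral_norm X * norm Y * (1 / lam - 1 / mu) < 1"
  shows "sing_val (Suc m) B = 0"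
proof (rule ccontr)
  assume nz: "sing_val (Suc m) B \<noteq> 0"
  let ?C = "dual_solution X Y lam" and ?D = "dual_solution X Y mu"
  let ?e = "spectral_norm X * norm Y * (1 / lam - 1 / mu)"
  note cert = primal_certificate[OF B lam(1), folded dual_solution_eq_residual[OF B lam(1)]]
  obtain v where v: "orthonormal_seq (Suc m) v"
    "\<And>w. w \<in> span (v ` {..<Suc m}) \<Longrightarrow> norm ((transpose X ** ?C) *v w) = norm w"
    by (rule nuclear_certificate_isometry[OF cert m nz]) (rule that)
  \<comment> \<open>The isometry at \<open>lam\<close> survives at \<open>mu\<close> up to the loss
    \<open>?e\<close>, on a subspace of dimension \<open>Suc m\<close>.\<close>
  have "1 - ?e \<le> sing_val (Suc m) (transpose X ** ?D)"
  proof (rule sing_val_ge_of_subspace[OF v(1)])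
    fix w assume w: "w \<in> span (v ` {..<Suc m})"
    have "(transpose X ** ?C) *v w = (transpose X ** ?D) *v w + transpose X *v ((?C - ?D) *v w)"
      by (simp add: matrix_vector_mul_assoc[symmetric] matrix_vector_mult_diff_rdistrib
          matrix_vector_mult_diff_distrib)
    then have "norm w \<le> norm ((transpose X ** ?D) *v w) + norm (transpose X *v ((?C - ?D) *v w))"
      using v(2)[OF w] by (metis norm_triangle_ineq)
    moreover have "norm (transpose X *v ((?C - ?D) *v w)) \<le> ?e * norm w"
    proof -
      have "norm (transpose X *v ((?C - ?D) *v w)) \<le> spectral_norm X * norm ((?C - ?D) *v w)"
        by (rule spectral_norm_transpose_le)
      \<comment> \<open>Nonexpansiveness controls the Frobenius norm of the difference, so the
        operator norm is bounded by it here.\<close>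
      also have "\<dots> \<le> spectral_norm X * (norm (?C - ?D) * norm w)"
        by (intro mult_left_mono norm_matrix_vector_le_Frobenius spectral_norm_nonneg)
      also have "\<dots> \<le> spectral_norm X * (((1 / lam - 1 / mu) * norm Y) * norm w)"
        by (intro mult_left_mono mult_right_mono norm_dual_solution_diff_le lam spectral_norm_nonneg) simp
      finally show ?thesis by (simp add: mult_ac)
    qed
    ultimately show "(1 - ?e) * norm w \<le> norm ((transpose X ** ?D) *v w)"
      by (simp add: algebra_simps)
  qed
  with small show False by linarith
qed

theorem theorem3p1:
  fixes X :: "real^'p^'n" and Y :: "real^'q^'n"
    and lambda0 lambda :: real and r i :: nat
    and B :: "real^'q^'p"
  assumes r: "r = min CARD('p) CARD('q)"
    and lambda0: "0 < lambda0" "lambda0 \<le> spectral_norm (transpose X ** Y)"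
    and i: "i \<in> {1..r}"
    and lambda: "0 < lambda" "lambda < lambda0"
    and bound: "lambda > lambda0 * spectral_norm X * norm Y /
        (lambda0 - lambda0 * sing_val i (transpose X ** dual_solution X Y lambda0)
          + spectral_norm X * norm Y)"
    and B: "primal_solution X Y lambda B"
  shows "(\<forall>j. i \<le> j \<and> j \<le> r \<longrightarrow> sing_val j B = 0) \<and> rank B \<le> i - 1"
proof -
  obtain m where m: "i = Suc m" "m < CARD('q)" using i r by (cases i) auto
  let ?N = "transpose X ** dual_solution X Y lambda0"
  let ?s = "sing_val i ?N" and ?a = "spectral_norm X * norm Y"
  \<comment> \<open>Feasibility bounds the largest singular value of \<open>?N\<close> by 1, hence
    also \<open>?s\<close>; this keeps the denominator of the bound positive.\<close>
  have "dual_solution X Y lambda0 \<in> dual_feasible X"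
    unfolding dual_solution_def
    by (rule closest_point_in_set[OF closed_dual_feasible]) (use zero_in_dual_feasible in blast)
  then have "sing_val (Suc 0) ?N \<le> 1" by (simp add: dual_feasible_def spectral_norm_def)
  with sing_val_antimono[of 0 m ?N] m have s: "?s \<le> 1" by simp
  \<comment> \<open>With \<open>lambda0\<close> positive and at most the left side, this yields
    \<open>?a > 0\<close>.\<close>
  have "spectral_norm (transpose X ** Y) \<le> spectral_norm X * norm Y"
    unfolding spectral_norm_le_iff matrix_vector_mul_assoc[symmetric] mult.assoc
    by (meson mult_left_mono norm_matrix_vector_le_Frobenius order_trans spectral_norm_nonneg
        spectral_norm_transpose_le)
  with lambda0 have a: "0 < ?a" by linarith
  have "0 \<le> lambda0 * (1 - ?s)" using s lambda0(1) by simp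
  with a have den: "0 < lambda0 - lambda0 * ?s + ?a" by (simp add: algebra_simps)
  have "lambda0 * ?a < lambda * (lambda0 - lambda0 * ?s + ?a)"
    using bound den by (simp add: divide_less_eq mult.assoc)
  \<comment> \<open>Collecting the terms in \<open>?a\<close> and dividing by
    \<open>lambda * lambda0\<close> turns the bound into the smallness condition of the screening
    rule.\<close>
  then have "?a * (lambda0 - lambda) < (1 - ?s) * (lambda * lambda0)"
    by (simp add: algebra_simps)
  then have "?a * (lambda0 - lambda) / (lambda * lambda0) < 1 - ?s"
    using lambda lambda0(1) by (simp add: pos_divide_less_eq)
  moreover have "?a * (lambda0 - lambda) / (lambda * lambda0) = ?a * (1 / lambda - 1 / lambda0)"
    using lambda lambda0(1) by (simp add: diff_frac_eq)
  ultimately have "?s + ?a * (1 / lambda - 1 / lambda0) < 1" by linarith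
  then have z: "sing_val (Suc m) B = 0"
    using screening_sing_val_eq_0[OF lambda(1) less_imp_le[OF lambda(2)] B m(2)] m(1) by simp
  have "sing_val j B = 0" if ij: "i \<le> j" "j \<le> r" for j
  proof -
    obtain k where k: "j = Suc k" "m \<le> k" "k < CARD('q)" using ij m(1) r by (cases j) auto
    show ?thesis using sing_val_antimono[OF k(2,3), of B] sing_val_nonneg[OF k(3), of B] z k(1) by simp
  qed
  moreover have "rank B \<le> i - 1" using rank_le_of_sing_val_eq_0[OF m(2) z] m(1) by simp
  ultimately show ?thesis by blast
qed

end
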